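(* Let $m\ge 3$ be an integer and let $QD_{2^m}=\langle a,b : a^{2^{m-1}}=b^2=1,\ bab^{-1}=a^{2^{m-2}-1}\rangle$ be the quasidihedral group. Then each of the graphs $\Gamma=\mathrm{ESCom}(QD_{2^m})$, $\Gamma=\mathrm{CSCom}(QD_{2^m})$ and $\Gamma=\mathrm{OSCom}(QD_{2^m})$ satisfies the Hansen--Vukičević inequality \[ \frac{M_2(\Gamma)}{|e(\Gamma)|}\ \ge\ \frac{M_1(\Gamma)}{|v(\Gamma)|}. \]
   Context: For an equivalence relation $B$ on a finite group $G$, with $[g]$ the class of $g$, the $B$ super commuting graph of $G$ is the simple graph with vertex set $G$ in which two distinct vertices $g,h$ are adjacent if and only if $[g]=[h]$ or there exist $g'\in[g]$, $h'\in[h]$ with $g'h'=h'g'$. It is denoted $\mathrm{ESCom}(G)$ when $B$ is equality (so $g\ne h$ are adjacent iff $gh=hg$), $\mathrm{CSCom}(G)$ when $B$ is conjugacy in $G$, and $\mathrm{OSCom}(G)$ when $B$ is the relation of having the same order. For a finite simple graph $\Gamma$ with vertex set $v(\Gamma)$ and edge set $e(\Gamma)$, the first and second Zagreb indices are $M_1(\Gamma)=\sum_{v\in v(\Gamma)}\deg(v)^2$ and $M_2(\Gamma)=\sum_{uv\in e(\Gamma)}\deg(u)\deg(v)$. *)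

theory Defs
  imports Complex_Main "HOL-Algebra.Multiplicative_Group"
begin

text \<open>
  Words over the alphabet \<open>'x\<close> and its formal inverses: \<open>(x, True)\<close> stands for the generator
  \<open>x\<close> and \<open>(x, False)\<close> for its inverse. All elements of \<open>'x\<close> are generators.
\<close>

type_synonym 'x gword = "('x \<times> bool) list"

definition gen :: "'x \<Rightarrow> 'x gword" where
  "gen x = [(x, True)]"

definition gen_inv :: "'x \<Rightarrow> 'x gword" where
  "gen_inv x = [(x, False)]"

definition wpow :: "'x gword \<Rightarrow> nat \<Rightarrow> 'x gword" where
  "wpow w n = concat (replicate n w)"

text \<open>
  The least congruence on words containing free cancellation and the relations \<open>l = r\<close>
  for \<open>(l, r) \<in> R\<close>.
\<close>

inductive pres_eq :: "('x gword \<times> 'x gword) set \<Rightarrow> 'x gword \<Rightarrow> 'x gword \<Rightarrow> bool"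
  for R :: "('x gword \<times> 'x gword) set" where
  pres_refl: "pres_eq R w w"
| pres_sym: "pres_eq R v w \<Longrightarrow> pres_eq R w v"
| pres_trans: "pres_eq R u v \<Longrightarrow> pres_eq R v w \<Longrightarrow> pres_eq R u w"
| pres_cancel: "pres_eq R (u @ [(x, s), (x, \<not> s)] @ v) (u @ v)"
| pres_rel: "(l, r) \<in> R \<Longrightarrow> pres_eq R (u @ l @ v) (u @ r @ v)"

definition pres_rel_set :: "('x gword \<times> 'x gword) set \<Rightarrow> 'x gword rel" where
  "pres_rel_set R = {(v, w). pres_eq R v w}"

definition presented_group :: "('x gword \<times> 'x gword) set \<Rightarrow> 'x gword set monoid" where
  "presented_group R =
    \<lparr> carrier = UNIV // pres_rel_set R,
      mult = (\<lambda>P Q. \<Union>x\<in>P. \<Union>y\<in>Q. pres_rel_set R `` {x @ y}),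
      one = pres_rel_set R `` {[]} \<rparr>"

lemma equiv_pres_rel_set: "equiv UNIV (pres_rel_set R)"
  by (intro equivI refl_onI symI transI)
    (auto simp: pres_rel_set_def intro: pres_eq.intros)

lemma pres_eq_append_left: "pres_eq R v w \<Longrightarrow> pres_eq R (u @ v) (u @ w)"
proof (induction rule: pres_eq.induct)
  case (pres_cancel u' x s v)
  show ?case using pres_eq.pres_cancel[of R "u @ u'" x s v] by simp
next
  case (pres_rel l r u' v)
  then show ?case using pres_eq.pres_rel[of l r R "u @ u'" v] by simp
qed (blast intro: pres_eq.intros)+

lemma pres_eq_append_right: "pres_eq R v w \<Longrightarrow> pres_eq R (v @ u) (w @ u)"
proof (induction rule: pres_eq.induct)
  case (pres_cancel u' x s v)
  show ?case using pres_eq.pres_cancel[of R u' x s "v @ u"] by simp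
next
  case (pres_rel l r u' v)
  then show ?case using pres_eq.pres_rel[of l r R u' "v @ u"] by simp
qed (blast intro: pres_eq.intros)+

lemma presented_group_mult:
  "pres_rel_set R `` {v} \<otimes>\<^bsub>presented_group R\<^esub> pres_rel_set R `` {w} = pres_rel_set R `` {v @ w}"
proof -
  have "(\<lambda>x y. pres_rel_set R `` {x @ y}) respects2 pres_rel_set R"
  proof (rule congruent2I')
    fix y1 z1 y2 z2
    assume "(y1, z1) \<in> pres_rel_set R" "(y2, z2) \<in> pres_rel_set R"
    then have "pres_eq R (y1 @ y2) (z1 @ z2)"
      unfolding pres_rel_set_def
      by (blast intro: pres_trans pres_eq_append_left pres_eq_append_right)
    then show "pres_rel_set R `` {y1 @ y2} = pres_rel_set R `` {z1 @ z2}"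
      by (intro equiv_class_eq[OF equiv_pres_rel_set]) (simp add: pres_rel_set_def)
  qed
  then show ?thesis
    unfolding presented_group_def
    by (simp add: UN_equiv_class2[OF equiv_pres_rel_set equiv_pres_rel_set])
qed

lemma pres_eq_inverse: "pres_eq R (rev (map (\<lambda>(x, s). (x, \<not> s)) w) @ w) []"
proof (induction w)
  case (Cons p w)
  obtain x s where p: "p = (x, s)" by (cases p)
  have "pres_eq R (rev (map (\<lambda>(x, s). (x, \<not> s)) w) @ [(x, \<not> s), (x, \<not> \<not> s)] @ w)
      (rev (map (\<lambda>(x, s). (x, \<not> s)) w) @ w)"
    by (rule pres_cancel)
  then show ?case using Cons.IH by (auto simp: p intro: pres_trans)
qed (simp add: pres_refl)

lemma group_presented_group: "group (presented_group R)"
proof (rule groupI)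
  let ?c = "\<lambda>w. pres_rel_set R `` {w}"
  have car: "P \<in> carrier (presented_group R) \<longleftrightarrow> (\<exists>w. P = ?c w)" for P
    by (auto simp: presented_group_def quotient_def)
  have one: "\<one>\<^bsub>presented_group R\<^esub> = ?c []"
    by (simp add: presented_group_def)
  show "P \<otimes>\<^bsub>presented_group R\<^esub> Q \<in> carrier (presented_group R)"
    if "P \<in> carrier (presented_group R)" "Q \<in> carrier (presented_group R)" for P Q
    using that unfolding car by (metis presented_group_mult)
  show "\<one>\<^bsub>presented_group R\<^esub> \<in> carrier (presented_group R)"
    unfolding car one by blast
  show "P \<otimes>\<^bsub>presented_group R\<^esub> Q \<otimes>\<^bsub>presented_group R\<^esub> T
      = P \<otimes>\<^bsub>presented_group R\<^esub> (Q \<otimes>\<^bsub>presented_group R\<^esub> T)"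
    if "P \<in> carrier (presented_group R)" "Q \<in> carrier (presented_group R)"
      "T \<in> carrier (presented_group R)" for P Q T
    using that unfolding car by (auto simp: presented_group_mult)
  show "\<one>\<^bsub>presented_group R\<^esub> \<otimes>\<^bsub>presented_group R\<^esub> P = P"
    if "P \<in> carrier (presented_group R)" for P
    using that unfolding car one by (auto simp: presented_group_mult)
  show "\<exists>Q\<in>carrier (presented_group R). Q \<otimes>\<^bsub>presented_group R\<^esub> P = \<one>\<^bsub>presented_group R\<^esub>"
    if P: "P \<in> carrier (presented_group R)" for P
  proof -
    obtain w where w: "P = ?c w" using P unfolding car by blast
    let ?v = "rev (map (\<lambda>(x, s). (x, \<not> s)) w)"
    have "?c (?v @ w) = ?c []"
      using pres_eq_inverse[of R w]
      by (intro equiv_class_eq[OF equiv_pres_rel_set]) (simp add: pres_rel_set_def)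
    then have "?c ?v \<otimes>\<^bsub>presented_group R\<^esub> P = \<one>\<^bsub>presented_group R\<^esub>"
      by (simp add: w one presented_group_mult)
    then show ?thesis using car by blast
  qed
qed

datatype qd_gen = a | b

text \<open>
  For \<open>m = 3\<close> the last relation reads \<open>b a b\<^sup>-\<^sup>1 = a\<close>, so the group is abelian; for
  \<open>m < 2\<close> the truncated subtractions make the definition meaningless.
\<close>

definition quasidihedral :: "nat \<Rightarrow> qd_gen gword set monoid" where
  "quasidihedral m = presented_group
    {(wpow (gen a) (2 ^ (m - 1)), []),
     (wpow (gen b) 2, []),
     (gen b @ gen a @ gen_inv b, wpow (gen a) (2 ^ (m - 2) - 1))}"

hide_const (open) a b

text \<open>The edges of a simple graph are two-element sets of vertices.\<close>

record 'v sgraph =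
  vertices :: "'v set"
  edges :: "'v set set"

definition degree :: "'v sgraph \<Rightarrow> 'v \<Rightarrow> nat" where
  "degree \<Gamma> v = card {e \<in> edges \<Gamma>. v \<in> e}"

definition zagreb1 :: "'v sgraph \<Rightarrow> nat" where
  "zagreb1 \<Gamma> = (\<Sum>v\<in>vertices \<Gamma>. degree \<Gamma> v ^ 2)"

text \<open>For an edge \<open>e = {u, v}\<close> the inner product is \<open>degree \<Gamma> u * degree \<Gamma> v\<close>.\<close>

definition zagreb2 :: "'v sgraph \<Rightarrow> nat" where
  "zagreb2 \<Gamma> = (\<Sum>e\<in>edges \<Gamma>. \<Prod>v\<in>e. degree \<Gamma> v)"

definition super_commuting_graph :: "('g, 'c) monoid_scheme \<Rightarrow> 'g rel \<Rightarrow> 'g sgraph" where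
  "super_commuting_graph G B =
    \<lparr> vertices = carrier G,
      edges = {{g, h} | g h. g \<in> carrier G \<and> h \<in> carrier G \<and> g \<noteq> h \<and>
        (B `` {g} = B `` {h} \<or>
         (\<exists>g'\<in>B `` {g}. \<exists>h'\<in>B `` {h}. g' \<otimes>\<^bsub>G\<^esub> h' = h' \<otimes>\<^bsub>G\<^esub> g'))} \<rparr>"

definition conjugacy_rel :: "('g, 'c) monoid_scheme \<Rightarrow> 'g rel" where
  "conjugacy_rel G = {(g, h). g \<in> carrier G \<and> h \<in> carrier G \<and>
    (\<exists>x\<in>carrier G. h = x \<otimes>\<^bsub>G\<^esub> g \<otimes>\<^bsub>G\<^esub> inv\<^bsub>G\<^esub> x)}"

definition same_order_rel :: "('g, 'c) monoid_scheme \<Rightarrow> 'g rel" where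
  "same_order_rel G = {(g, h). g \<in> carrier G \<and> h \<in> carrier G \<and> group.ord G g = group.ord G h}"

definition ESCom :: "('g, 'c) monoid_scheme \<Rightarrow> 'g sgraph" where
  "ESCom G = super_commuting_graph G (Id_on (carrier G))"

definition CSCom :: "('g, 'c) monoid_scheme \<Rightarrow> 'g sgraph" where
  "CSCom G = super_commuting_graph G (conjugacy_rel G)"

definition OSCom :: "('g, 'c) monoid_scheme \<Rightarrow> 'g sgraph" where
  "OSCom G = super_commuting_graph G (same_order_rel G)"

end

theory Submission
  imports Defs "HOL-Computational_Algebra.Primes"
begin

text \<open>
  All three graphs have the same shape: some vertices are adjacent to every other vertex, and the
  remaining vertices fall into disjoint cliques. The inequality holds for every finite graph of
  this shape (\<open>dominated_cluster_graph.hansen_vukicevic\<close>). Let \<open>c\<close> be the number of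
  dominating vertices, \<open>W\<close> the set of the others, \<open>D\<close> the degree of a dominating vertex
  (one less than the number of vertices), and \<open>S k\<close> the sum of the \<open>k\<close>-th powers of the
  degrees over \<open>W\<close>. A vertex of degree \<open>d\<close> in \<open>W\<close> has \<open>c\<close> neighbours of degree \<open>D\<close> and
  \<open>d - c\<close> neighbours of degree \<open>d\<close>, so all sums can be computed:
  the difference of the two sides, multiplied by \<open>2\<close> and by the numbers of vertices and edges, is

  \<open>(card W * S 3 - S 1 * S 2) + c * (\<Sum>v\<in>W. (d v - 1) * (d v - D)\<^sup>2)\<close>.

  The first term is nonnegative by Chebyshev's sum inequality. So is the second, because a
  vertex of \<open>W\<close> has degree at least one as soon as there is a dominating vertex.

  For ESCom and CSCom the shape comes from the abelian subgroup \<open>A\<close> of index at most two that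
  is generated by the rotation \<open>a\<close>. An element of \<open>A\<close> that commutes with an element outside
  \<open>A\<close> is central, so noncentral elements in and outside \<open>A\<close> are never adjacent; elements of
  \<open>A\<close> are pairwise adjacent; and two commuting elements outside \<open>A\<close> differ by a central factor,
  which makes adjacency outside \<open>A\<close> transitive. The central elements dominate.

  OSCom of a finite p-group is complete: if the order of \<open>x\<close> divides that of \<open>y\<close>, then some
  power of \<open>y\<close> has the order of \<open>x\<close>, and it commutes with \<open>y\<close>.

  The relations of the presentation bring every word into the form \<open>a\<^sup>i\<close> or \<open>a\<^sup>i b\<close>. Hence the
  group is finite, \<open>A\<close> has index at most two, and the square of every element lies in \<open>A\<close>, so
  that all orders are powers of two.
\<close>

section \<open>Degree sums in finite simple graphs\<close>

locale finite_simple_graph =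
  fixes \<Gamma> :: "'v sgraph"
  assumes finite_vertices: "finite (vertices \<Gamma>)"
    and edge_subset: "e \<in> edges \<Gamma> \<Longrightarrow> e \<subseteq> vertices \<Gamma>"
    and edge_card: "e \<in> edges \<Gamma> \<Longrightarrow> card e = 2"
begin

definition nbrs :: "'v \<Rightarrow> 'v set" where
  "nbrs v = {u. {u, v} \<in> edges \<Gamma>}"

lemma finite_edges: "finite (edges \<Gamma>)"
proof (rule finite_subset)
  show "edges \<Gamma> \<subseteq> Pow (vertices \<Gamma>)" using edge_subset by blast
  show "finite (Pow (vertices \<Gamma>))" using finite_vertices by simp
qed

lemma nbrs_subset: "nbrs v \<subseteq> vertices \<Gamma> - {v}"
proof
  fix u assume u: "u \<in> nbrs v"
  then have "{u, v} \<in> edges \<Gamma>" by (simp add: nbrs_def)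
  then have "{u, v} \<subseteq> vertices \<Gamma>" "card {u, v} = 2" by (rule edge_subset, rule edge_card)
  then show "u \<in> vertices \<Gamma> - {v}" by (cases "u = v") auto
qed

lemma finite_nbrs: "finite (nbrs v)"
  using nbrs_subset finite_vertices by (meson finite_Diff finite_subset)

lemma nbrs_commute: "u \<in> nbrs v \<longleftrightarrow> v \<in> nbrs u"
  by (simp add: nbrs_def insert_commute)

lemma bij_betw_nbrs_incident: "bij_betw (\<lambda>u. {u, v}) (nbrs v) {e \<in> edges \<Gamma>. v \<in> e}"
proof (rule bij_betwI')
  fix e assume e: "e \<in> {e \<in> edges \<Gamma>. v \<in> e}"
  then have "card e = 2" using edge_card by simp
  then obtain x y where "e = {x, y}" by (meson card_2_iff)
  then have "e = {y, v} \<or> e = {x, v}" using e by auto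
  then show "\<exists>u\<in>nbrs v. e = {u, v}" using e by (auto simp: nbrs_def)
next
  fix u w show "{u, v} = {w, v} \<longleftrightarrow> u = w" by (auto simp: doubleton_eq_iff)
next
  fix u assume "u \<in> nbrs v"
  then show "{u, v} \<in> {e \<in> edges \<Gamma>. v \<in> e}" by (simp add: nbrs_def)
qed

lemma degree_eq_card_nbrs: "degree \<Gamma> v = card (nbrs v)"
  using bij_betw_same_card[OF bij_betw_nbrs_incident] by (simp add: degree_def)

text \<open>Double counting: every edge is met once from each of its two ends.\<close>

lemma sum_over_nbrs:
  fixes F :: "'v set \<Rightarrow> real"
  shows "(\<Sum>v\<in>vertices \<Gamma>. \<Sum>u\<in>nbrs v. F {u, v}) = 2 * (\<Sum>e\<in>edges \<Gamma>. F e)"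
proof -
  have "(\<Sum>v\<in>vertices \<Gamma>. \<Sum>u\<in>nbrs v. F {u, v})
      = (\<Sum>v\<in>vertices \<Gamma>. \<Sum>e\<in>{e \<in> edges \<Gamma>. v \<in> e}. F e)"
    by (intro sum.cong refl sum.reindex_bij_betw[OF bij_betw_nbrs_incident])
  also have "\<dots> = (\<Sum>e\<in>edges \<Gamma>. \<Sum>v\<in>{v \<in> vertices \<Gamma>. v \<in> e}. F e)"
    by (rule sum.swap_restrict[OF finite_vertices finite_edges])
  also have "\<dots> = (\<Sum>e\<in>edges \<Gamma>. 2 * F e)"
  proof (intro sum.cong refl)
    fix e assume e: "e \<in> edges \<Gamma>"
    then have "{v \<in> vertices \<Gamma>. v \<in> e} = e" using edge_subset by auto
    then show "(\<Sum>v\<in>{v \<in> vertices \<Gamma>. v \<in> e}. F e) = 2 * F e" using edge_card[OF e] by simp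
  qed
  also have "\<dots> = 2 * (\<Sum>e\<in>edges \<Gamma>. F e)" by (rule sum_distrib_left[symmetric])
  finally show ?thesis .
qed

lemma sum_degree: "(\<Sum>v\<in>vertices \<Gamma>. real (degree \<Gamma> v)) = 2 * real (card (edges \<Gamma>))"
proof -
  have "(\<Sum>v\<in>vertices \<Gamma>. real (degree \<Gamma> v)) = (\<Sum>v\<in>vertices \<Gamma>. \<Sum>u\<in>nbrs v. 1)"
    by (simp add: degree_eq_card_nbrs)
  also have "\<dots> = 2 * (\<Sum>e\<in>edges \<Gamma>. 1)" by (rule sum_over_nbrs)
  also have "(\<Sum>e\<in>edges \<Gamma>. 1) = real (card (edges \<Gamma>))" by simp
  finally show ?thesis .
qed

lemma sum_degree_nbrs:
  "(\<Sum>v\<in>vertices \<Gamma>. real (degree \<Gamma> v) * (\<Sum>u\<in>nbrs v. real (degree \<Gamma> u)))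
    = 2 * real (zagreb2 \<Gamma>)"
proof -
  let ?F = "\<lambda>e. \<Prod>v\<in>e. real (degree \<Gamma> v)"
  have "real (degree \<Gamma> v) * (\<Sum>u\<in>nbrs v. real (degree \<Gamma> u)) = (\<Sum>u\<in>nbrs v. ?F {u, v})" for v
    unfolding sum_distrib_left
  proof (intro sum.cong refl)
    fix u assume "u \<in> nbrs v"
    then have "u \<noteq> v" using nbrs_subset by blast
    then show "real (degree \<Gamma> v) * real (degree \<Gamma> u) = ?F {u, v}" by (simp add: mult.commute)
  qed
  then have "(\<Sum>v\<in>vertices \<Gamma>. real (degree \<Gamma> v) * (\<Sum>u\<in>nbrs v. real (degree \<Gamma> u)))
      = (\<Sum>v\<in>vertices \<Gamma>. \<Sum>u\<in>nbrs v. ?F {u, v})"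
    by (intro sum.cong refl)
  also have "\<dots> = 2 * (\<Sum>e\<in>edges \<Gamma>. ?F e)" by (rule sum_over_nbrs)
  also have "(\<Sum>e\<in>edges \<Gamma>. ?F e) = real (zagreb2 \<Gamma>)" by (simp add: zagreb2_def)
  finally show ?thesis .
qed

end

section \<open>The Hansen--Vukicevic inequality for dominated cluster graphs\<close>

text \<open>A Chebyshev sum inequality: \<open>d\<close> and \<open>d\<^sup>2\<close> are equally ordered, so the double sum of
  \<open>(d u - d v) * ((d u)\<^sup>2 - (d v)\<^sup>2)\<close> is nonnegative.\<close>

lemma sum_times_sum_squares_le:
  fixes d :: "'a \<Rightarrow> real"
  assumes "\<And>v. v \<in> W \<Longrightarrow> 0 \<le> d v"
  shows "(\<Sum>v\<in>W. d v) * (\<Sum>v\<in>W. d v ^ 2) \<le> real (card W) * (\<Sum>v\<in>W. d v ^ 3)"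
proof -
  have "0 \<le> (\<Sum>u\<in>W. \<Sum>v\<in>W. (d u + d v) * (d u - d v) ^ 2)"
    using assms by (intro sum_nonneg mult_nonneg_nonneg) auto
  also have "\<dots> = (\<Sum>u\<in>W. \<Sum>v\<in>W. d u ^ 3 + d v ^ 3 - d u * d v ^ 2 - d u ^ 2 * d v)"
    by (intro sum.cong refl) (simp add: power2_eq_square power3_eq_cube algebra_simps)
  also have "\<dots> = 2 * (real (card W) * (\<Sum>v\<in>W. d v ^ 3) - (\<Sum>v\<in>W. d v) * (\<Sum>v\<in>W. d v ^ 2))"
    by (simp add: sum.distrib sum_subtractf flip: sum_distrib_left sum_distrib_right)
  finally show ?thesis by simp
qed

text \<open>After removal of the vertices in \<open>C\<close>, which are adjacent to everything, a disjoint
  union of cliques remains. This is expressed by transitivity of adjacency outside \<open>C\<close>; the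
  condition \<open>u \<noteq> w\<close> is there because edges have two distinct ends.\<close>

locale dominated_cluster_graph = finite_simple_graph \<Gamma> for \<Gamma> :: "'v sgraph" +
  fixes C :: "'v set"
  assumes dominating_subset: "C \<subseteq> vertices \<Gamma>"
    and dominating: "c \<in> C \<Longrightarrow> v \<in> vertices \<Gamma> \<Longrightarrow> v \<noteq> c \<Longrightarrow> {c, v} \<in> edges \<Gamma>"
    and transitive: "{u, v} \<in> edges \<Gamma> \<Longrightarrow> {v, w} \<in> edges \<Gamma> \<Longrightarrow> u \<noteq> w
      \<Longrightarrow> u \<notin> C \<Longrightarrow> v \<notin> C \<Longrightarrow> w \<notin> C \<Longrightarrow> {u, w} \<in> edges \<Gamma>"
begin

lemma nbrs_dominating: "c \<in> C \<Longrightarrow> nbrs c = vertices \<Gamma> - {c}"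
  using nbrs_subset[of c] dominating[of c] by (auto simp: nbrs_def insert_commute)

lemma dominating_subset_nbrs: "v \<in> vertices \<Gamma> - C \<Longrightarrow> C \<subseteq> nbrs v"
  using dominating by (auto simp: nbrs_def)

text \<open>Adjacent vertices outside \<open>C\<close> have the same closed neighbourhood.\<close>

lemma degree_eq_in_cluster:
  assumes v: "v \<in> vertices \<Gamma> - C" and u: "u \<in> nbrs v - C"
  shows "degree \<Gamma> u = degree \<Gamma> v"
proof -
  have sub: "insert y (nbrs y) \<subseteq> insert x (nbrs x)"
    if "x \<in> vertices \<Gamma> - C" "y \<in> nbrs x - C" for x y
  proof
    fix w assume w: "w \<in> insert y (nbrs y)"
    consider "w = y" | "w = x" | "w \<in> C" | "w \<in> nbrs y" "w \<noteq> x" "w \<notin> C" using w by auto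
    then show "w \<in> insert x (nbrs x)"
    proof cases
      case 4
      then have "{w, x} \<in> edges \<Gamma>"
        using that by (intro transitive[of w y x]) (auto simp: nbrs_def)
      then show ?thesis by (simp add: nbrs_def)
    qed (use that dominating_subset_nbrs in auto)
  qed
  have "u \<in> vertices \<Gamma> - C" "v \<in> nbrs u - C"
    using u v nbrs_subset[of v] nbrs_commute by auto
  then have "insert u (nbrs u) = insert v (nbrs v)"
    using sub[of v u] sub[of u v] u v by auto
  then have "card (insert u (nbrs u)) = card (insert v (nbrs v))" by simp
  moreover have "u \<notin> nbrs u" "v \<notin> nbrs v" using nbrs_subset by auto
  ultimately show ?thesis by (simp add: finite_nbrs degree_eq_card_nbrs)
qed

text \<open>The difference of the two sides is computed in terms of the power sums of the degrees
  outside \<open>C\<close> and then rearranged into two visibly nonnegative parts.\<close>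

theorem zagreb_cross_mult:
  "real (zagreb1 \<Gamma>) * real (card (edges \<Gamma>)) \<le> real (zagreb2 \<Gamma>) * real (card (vertices \<Gamma>))"
proof -
  define d where "d v = real (degree \<Gamma> v)" for v
  define W where "W = vertices \<Gamma> - C"
  define c where "c = real (card C)"
  define n' where "n' = real (card W)"
  define D where "D = n' + c - 1"
  define S where "S k = (\<Sum>v\<in>W. d v ^ k)" for k :: nat
  have fin: "finite C" "finite W"
    using dominating_subset finite_vertices by (auto simp: W_def finite_subset)
  have V: "vertices \<Gamma> = C \<union> W" "C \<inter> W = {}" using dominating_subset by (auto simp: W_def)
  have card_V: "real (card (vertices \<Gamma>)) = n' + c"
    using V fin by (simp add: card_Un_disjoint n'_def c_def)
  have split: "(\<Sum>v\<in>vertices \<Gamma>. f v) = (\<Sum>v\<in>C. f v) + (\<Sum>v\<in>W. f v)" for f :: "'v \<Rightarrow> real"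
    using V fin by (simp add: sum.union_disjoint)
  have dC: "d v = D" if "v \<in> C" for v
  proof -
    have v: "v \<in> vertices \<Gamma>" using that dominating_subset by auto
    have "card (vertices \<Gamma>) = Suc (card (nbrs v))"
      unfolding nbrs_dominating[OF that] using v finite_vertices by (rule card.remove[rotated])
    then show ?thesis using card_V by (simp add: d_def D_def degree_eq_card_nbrs)
  qed
  have sum_d: "(\<Sum>v\<in>vertices \<Gamma>. d v) = c * D + S 1"
    using dC by (simp add: split S_def c_def)
  have nbrs_C: "(\<Sum>u\<in>nbrs v. d u) = c * D + S 1 - D" if "v \<in> C" for v
    using that dominating_subset dC sum_d
    by (subst nbrs_dominating[OF that]) (auto simp: sum_diff1 finite_vertices)
  have nbrs_W: "(\<Sum>u\<in>nbrs v. d u) = c * D + (d v - c) * d v" if v: "v \<in> W" for v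
  proof -
    have sub: "C \<subseteq> nbrs v" using dominating_subset_nbrs v by (simp add: W_def)
    have "(\<Sum>u\<in>nbrs v. d u) = (\<Sum>u\<in>nbrs v - C. d u) + (\<Sum>u\<in>C. d u)"
      by (rule sum.subset_diff[OF sub finite_nbrs])
    also have "(\<Sum>u\<in>nbrs v - C. d u) = (\<Sum>u\<in>nbrs v - C. d v)"
      using degree_eq_in_cluster v by (intro sum.cong refl) (auto simp: d_def W_def)
    also have "\<dots> = (d v - c) * d v"
      using sub fin card_mono[OF finite_nbrs sub]
      by (simp add: card_Diff_subset d_def c_def degree_eq_card_nbrs of_nat_diff)
    also have "(\<Sum>u\<in>C. d u) = c * D" using dC by (simp add: c_def)
    finally show ?thesis by simp
  qed
  have E: "2 * real (card (edges \<Gamma>)) = c * D + S 1"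
    using sum_d sum_degree by (simp add: d_def)
  have M1: "real (zagreb1 \<Gamma>) = c * D ^ 2 + S 2"
  proof -
    have "real (zagreb1 \<Gamma>) = (\<Sum>v\<in>vertices \<Gamma>. d v ^ 2)" by (simp add: zagreb1_def d_def)
    then show ?thesis using dC by (simp add: split S_def c_def)
  qed
  have M2: "2 * real (zagreb2 \<Gamma>) = c * D * (c * D + S 1 - D) + c * D * S 1 + S 3 - c * S 2"
  proof -
    have "2 * real (zagreb2 \<Gamma>) = (\<Sum>v\<in>vertices \<Gamma>. d v * (\<Sum>u\<in>nbrs v. d u))"
      using sum_degree_nbrs by (simp add: d_def)
    also have "\<dots> = (\<Sum>v\<in>C. D * (c * D + S 1 - D)) + (\<Sum>v\<in>W. d v * (c * D + (d v - c) * d v))"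
      unfolding split using dC nbrs_C nbrs_W by simp
    also have "(\<Sum>v\<in>W. d v * (c * D + (d v - c) * d v))
        = (\<Sum>v\<in>W. c * D * d v ^ 1 + d v ^ 3 - c * d v ^ 2)"
      by (intro sum.cong refl) (simp add: power2_eq_square power3_eq_cube algebra_simps)
    also have "\<dots> = c * D * S 1 + S 3 - c * S 2"
      by (simp add: S_def sum.distrib sum_subtractf sum_distrib_left)
    finally show ?thesis by (simp add: c_def)
  qed
  \<comment> \<open>\<open>P\<close> collects what remains of the difference, divided by \<open>c\<close>, once the Chebyshev part
    is split off; as a polynomial in one degree it has the double root \<open>D\<close>.\<close>
  define P where "P = (\<Sum>v\<in>W. (d v - 1) * (d v - D) ^ 2)"
  have P: "P = S 3 - (2 * D + 1) * S 2 + D * (D + 2) * S 1 - D ^ 2 * n'"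
  proof -
    have "P = (\<Sum>v\<in>W. d v ^ 3 - (2 * D + 1) * d v ^ 2 + D * (D + 2) * d v ^ 1 - D ^ 2)"
      unfolding P_def
      by (intro sum.cong refl) (simp add: power2_eq_square power3_eq_cube algebra_simps)
    then show ?thesis by (simp add: S_def sum.distrib sum_subtractf sum_distrib_left n'_def)
  qed
  have "0 \<le> c * P"
  proof (cases "C = {}")
    case False
    have "1 \<le> d v" if "v \<in> W" for v
    proof -
      have "nbrs v \<noteq> {}" using False dominating_subset_nbrs that by (auto simp: W_def)
      then show ?thesis
        using finite_nbrs[of v] card_gt_0_iff[of "nbrs v"] by (simp add: d_def degree_eq_card_nbrs)
    qed
    then have "0 \<le> P" unfolding P_def by (intro sum_nonneg mult_nonneg_nonneg) auto
    then show ?thesis by (simp add: c_def)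
  qed (simp add: c_def)
  moreover have "S 1 * S 2 \<le> n' * S 3"
    using sum_times_sum_squares_le[of W d] by (simp add: S_def n'_def d_def)
  moreover have "2 * real (zagreb2 \<Gamma>) * (n' + c) - real (zagreb1 \<Gamma>) * (2 * real (card (edges \<Gamma>)))
      = (n' * S 3 - S 1 * S 2) + c * P"
  proof -
    have n': "n' = D + 1 - c" by (simp add: D_def)
    show ?thesis unfolding E M1 M2 P n' by (simp add: power2_eq_square algebra_simps)
  qed
  ultimately show ?thesis unfolding card_V by (simp add: algebra_simps)
qed

corollary hansen_vukicevic:
  "real (zagreb2 \<Gamma>) / real (card (edges \<Gamma>)) \<ge> real (zagreb1 \<Gamma>) / real (card (vertices \<Gamma>))"
proof (cases "edges \<Gamma> = {}")
  case True
  then show ?thesis by (simp add: zagreb1_def degree_def)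
next
  case False
  then have "card (edges \<Gamma>) > 0" using finite_edges by (simp add: card_gt_0_iff)
  moreover have "card (vertices \<Gamma>) > 0"
  proof -
    obtain e where "e \<in> edges \<Gamma>" using False by auto
    then have "e \<subseteq> vertices \<Gamma>" "e \<noteq> {}" using edge_subset edge_card by fastforce+
    then show ?thesis using finite_vertices by (auto simp: card_gt_0_iff)
  qed
  ultimately show ?thesis using zagreb_cross_mult by (simp add: field_simps)
qed

end

section \<open>Super commuting graphs\<close>

lemma vertices_super_commuting_graph [simp]:
  "vertices (super_commuting_graph G B) = carrier G"
  by (simp add: super_commuting_graph_def)

lemma edge_super_commuting_graph_iff:
  "{x, y} \<in> edges (super_commuting_graph G B) \<longleftrightarrow>
    x \<in> carrier G \<and> y \<in> carrier G \<and> x \<noteq> y \<and>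
    (B `` {x} = B `` {y} \<or> (\<exists>x'\<in>B `` {x}. \<exists>y'\<in>B `` {y}. x' \<otimes>\<^bsub>G\<^esub> y' = y' \<otimes>\<^bsub>G\<^esub> x'))"
  (is "?l \<longleftrightarrow> ?P x y")
proof
  assume ?l
  then obtain g h where gh: "{x, y} = {g, h}" "?P g h"
    unfolding super_commuting_graph_def by auto
  have sym: "?P h g" using gh(2) by metis
  from gh(1) consider "x = g" "y = h" | "x = h" "y = g" by (auto simp: doubleton_eq_iff)
  then show "?P x y" by cases (use gh(2) sym in simp_all)
next
  assume "?P x y"
  then show ?l unfolding super_commuting_graph_def by auto
qed

lemma finite_simple_graph_super_commuting_graph:
  assumes "finite (carrier G)"
  shows "finite_simple_graph (super_commuting_graph G B)"
proof
  fix e assume "e \<in> edges (super_commuting_graph G B)"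
  then obtain g h where "e = {g, h}" "g \<in> carrier G" "h \<in> carrier G" "g \<noteq> h"
    unfolding super_commuting_graph_def by auto
  then show "e \<subseteq> vertices (super_commuting_graph G B)" "card e = 2" by auto
qed (use assms in simp)

section \<open>Groups with an abelian subgroup of index at most two\<close>

definition center :: "('g, 'c) monoid_scheme \<Rightarrow> 'g set" where
  "center G = {z \<in> carrier G. \<forall>x\<in>carrier G. z \<otimes>\<^bsub>G\<^esub> x = x \<otimes>\<^bsub>G\<^esub> z}"

lemma (in group) conj_inverse:
  assumes "g \<in> carrier G" "x \<in> carrier G"
  shows "inv g \<otimes> (g \<otimes> x \<otimes> inv g) \<otimes> g = x"
proof -
  have "inv g \<otimes> (g \<otimes> x \<otimes> inv g) \<otimes> g = (inv g \<otimes> g) \<otimes> x \<otimes> (inv g \<otimes> g)"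
    using assms by (simp only: m_assoc m_closed inv_closed)
  then show ?thesis using assms by simp
qed

text \<open>The index condition says that the product of any two elements outside \<open>A\<close> falls into \<open>A\<close>.
  It allows \<open>A\<close> to be the whole group, which makes abelian groups an instance.\<close>

locale abelian_index_two = group G for G (structure) +
  fixes A
  assumes subgroup_A: "subgroup A G"
    and comm_A: "x \<in> A \<Longrightarrow> y \<in> A \<Longrightarrow> x \<otimes> y = y \<otimes> x"
    and index_A: "x \<in> carrier G - A \<Longrightarrow> y \<in> carrier G - A \<Longrightarrow> x \<otimes> y \<in> A"
begin

lemma A_closed [simp]: "x \<in> A \<Longrightarrow> x \<in> carrier G"
  using subgroup.mem_carrier[OF subgroup_A] .

lemma inv_notin_A: "x \<in> carrier G - A \<Longrightarrow> inv x \<in> carrier G - A"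
  using subgroup.m_inv_closed[OF subgroup_A, of "inv x"] by auto

lemma mult_notin_A:
  assumes "x \<in> A" "y \<in> carrier G - A"
  shows "x \<otimes> y \<in> carrier G - A"
proof -
  have "y = inv x \<otimes> (x \<otimes> y)" using assms by (simp add: m_assoc[symmetric])
  then have "x \<otimes> y \<notin> A"
    using assms subgroup.m_closed[OF subgroup_A] subgroup.m_inv_closed[OF subgroup_A] by (metis DiffD2)
  then show ?thesis using assms by simp
qed

lemma conj_mem_A:
  assumes "x \<in> A" "g \<in> carrier G"
  shows "g \<otimes> x \<otimes> inv g \<in> A"
proof (cases "g \<in> A")
  case True
  then show ?thesis
    using assms subgroup.m_closed[OF subgroup_A] subgroup.m_inv_closed[OF subgroup_A] by simp
next
  case False
  then have "x \<otimes> inv g \<in> carrier G - A" using assms mult_notin_A inv_notin_A by simp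
  then have "g \<otimes> (x \<otimes> inv g) \<in> A" using False assms index_A by simp
  then show ?thesis using assms by (simp add: m_assoc)
qed

lemma conjugate_mem_A_iff:
  assumes "(x, y) \<in> conjugacy_rel G"
  shows "x \<in> A \<longleftrightarrow> y \<in> A"
proof -
  obtain g where g: "g \<in> carrier G" "x \<in> carrier G" "y = g \<otimes> x \<otimes> inv g"
    using assms unfolding conjugacy_rel_def by auto
  have "x = inv g \<otimes> y \<otimes> inv (inv g)" using g by (simp add: conj_inverse)
  then show ?thesis using g conj_mem_A[of x g] conj_mem_A[of y "inv g"] by auto
qed

lemma conjugate_of_central:
  assumes "(x, z) \<in> conjugacy_rel G" "z \<in> center G"
  shows "x = z"
proof -
  obtain g where g: "g \<in> carrier G" "x \<in> carrier G" "z = g \<otimes> x \<otimes> inv g"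
    using assms unfolding conjugacy_rel_def by auto
  have zc: "z \<in> carrier G" "z \<otimes> g = g \<otimes> z" using assms g by (auto simp: center_def)
  have "z \<otimes> g = g \<otimes> x" using g by (simp add: m_assoc)
  then have "g \<otimes> z = g \<otimes> x" using zc by simp
  then show ?thesis using g zc by simp
qed

text \<open>The centralizer of \<open>x\<close> contains the abelian subgroup \<open>A\<close> and the element \<open>y\<close> outside it,
  and these generate the group because \<open>A\<close> has index two.\<close>

lemma central_of_commutes:
  assumes x: "x \<in> A" and y: "y \<in> carrier G - A" and xy: "x \<otimes> y = y \<otimes> x"
  shows "x \<in> center G"
proof -
  have "x \<otimes> g = g \<otimes> x" if g: "g \<in> carrier G" for g
  proof (cases "g \<in> A")
    case False
    define k where "k = g \<otimes> inv y"
    have k: "k \<in> A" unfolding k_def using False g y inv_notin_A index_A by simp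
    have gk: "g = k \<otimes> y" using g y by (simp add: k_def m_assoc)
    have "x \<otimes> g = (x \<otimes> k) \<otimes> y" using x y k by (simp add: gk m_assoc)
    also have "\<dots> = k \<otimes> (x \<otimes> y)" using x y k by (simp add: comm_A[OF x k] m_assoc)
    also have "\<dots> = g \<otimes> x" using x y k by (simp add: gk m_assoc xy)
    finally show ?thesis .
  qed (use x comm_A in simp)
  then show ?thesis using x by (simp add: center_def)
qed

text \<open>The quotient \<open>inv x \<otimes> y\<close> lies in \<open>A\<close> and commutes with \<open>x\<close>, which is outside \<open>A\<close>.\<close>

lemma commutes_off_A:
  assumes x: "x \<in> carrier G - A" and y: "y \<in> carrier G - A" and xy: "x \<otimes> y = y \<otimes> x"
  obtains z where "z \<in> center G" "y = x \<otimes> z"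
proof
  define z where "z = inv x \<otimes> y"
  have "z \<in> A" unfolding z_def using x y inv_notin_A index_A by blast
  moreover have "z \<otimes> x = x \<otimes> z"
    using x y xy by (simp add: z_def m_assoc flip: xy) (simp flip: m_assoc)
  ultimately show "z \<in> center G" using central_of_commutes x by blast
  show "y = x \<otimes> z" using x y by (simp add: z_def flip: m_assoc)
qed

text \<open>Equality and conjugacy are treated together: both are equivalence relations finer than or
  equal to conjugacy, and both are compatible with multiplication by central elements. The first
  property keeps \<open>A\<close> and the center unions of classes; the second lets a central factor be
  moved from one representative of a class to another, which gives transitivity outside \<open>A\<close>.\<close>

lemma dominated_cluster_graph_super_commuting_graph:
  assumes fin: "finite (carrier G)"
    and equiv: "equiv (carrier G) B"
    and conj: "B \<subseteq> conjugacy_rel G"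
    and central: "\<And>x y z. (x, y) \<in> B \<Longrightarrow> z \<in> center G \<Longrightarrow> (x \<otimes> z, y \<otimes> z) \<in> B"
  shows "dominated_cluster_graph (super_commuting_graph G B) (center G)"
proof -
  let ?\<Gamma> = "super_commuting_graph G B"
  have refl: "(x, x) \<in> B" if "x \<in> carrier G" for x using that equiv by (auto simp: equiv_def refl_on_def)
  have sym: "(y, x) \<in> B" if "(x, y) \<in> B" for x y using that equiv by (auto simp: equiv_def sym_def)
  have trans: "(x, w) \<in> B" if "(x, y) \<in> B" "(y, w) \<in> B" for x y w
    using that equiv unfolding equiv_def trans_def by blast
  have mem_A: "x \<in> A \<longleftrightarrow> y \<in> A" if "(x, y) \<in> B" for x y
    using that conj conjugate_mem_A_iff by blast
  have closed: "x \<in> carrier G" "y \<in> carrier G" if "(x, y) \<in> B" for x y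
    using that conj by (auto simp: conjugacy_rel_def)
  \<comment> \<open>For noncentral elements, \<open>link\<close> is the relation of being adjacent or equal.\<close>
  define link where "link x y \<longleftrightarrow> x \<in> A \<and> y \<in> A \<or>
      x \<notin> A \<and> y \<notin> A \<and> (\<exists>z\<in>center G. (x \<otimes> z, y) \<in> B)" for x y
  have edge_iff: "{x, y} \<in> edges ?\<Gamma> \<longleftrightarrow> x \<noteq> y \<and> link x y"
    if x: "x \<in> carrier G - center G" and y: "y \<in> carrier G - center G" for x y
  proof
    assume "{x, y} \<in> edges ?\<Gamma>"
    then consider "B `` {x} = B `` {y}"
      | x' y' where "(x, x') \<in> B" "(y, y') \<in> B" "x' \<otimes> y' = y' \<otimes> x'"
      unfolding edge_super_commuting_graph_iff by auto
    then have "link x y"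
    proof cases
      case 1
      then have xy: "(x, y) \<in> B" using refl y by blast
      moreover have "\<one> \<in> center G" by (simp add: center_def)
      ultimately show ?thesis using mem_A[OF xy] x unfolding link_def by (metis DiffD1 r_one)
    next
      case 2
      have c: "x' \<in> carrier G" "y' \<in> carrier G" using closed 2 by blast+
      have nz: "x' \<notin> center G" "y' \<notin> center G"
        using conjugate_of_central 2 conj x y by blast+
      have iff: "x' \<in> A \<longleftrightarrow> y' \<in> A"
        using central_of_commutes[of x' y'] central_of_commutes[of y' x'] nz c 2(3) by auto
      show ?thesis
      proof (cases "x' \<in> A")
        case True
        then show ?thesis using iff mem_A 2 by (simp add: link_def)
      next
        case False
        then obtain z where z: "z \<in> center G" "y' = x' \<otimes> z"
          using commutes_off_A[of x' y'] c iff 2(3) by auto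
        then have "(x \<otimes> z, y) \<in> B" using central[OF 2(1) z(1)] sym[OF 2(2)] trans by blast
        then show ?thesis using z False iff mem_A[OF 2(1)] mem_A[OF 2(2)] by (auto simp: link_def)
      qed
    qed
    then show "x \<noteq> y \<and> link x y"
      using \<open>{x, y} \<in> edges ?\<Gamma>\<close> unfolding edge_super_commuting_graph_iff by blast
  next
    assume xy: "x \<noteq> y \<and> link x y"
    have "\<exists>x'\<in>B `` {x}. \<exists>y'\<in>B `` {y}. x' \<otimes> y' = y' \<otimes> x'"
    proof (cases "x \<in> A")
      case True
      then have "x \<otimes> y = y \<otimes> x" using xy comm_A by (auto simp: link_def)
      then show ?thesis using refl x y by blast
    next
      case False
      then obtain z where z: "z \<in> center G" "(x \<otimes> z, y) \<in> B" using xy by (auto simp: link_def)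
      then have "z \<in> carrier G" "z \<otimes> x = x \<otimes> z" using x by (auto simp: center_def)
      then have "x \<otimes> (x \<otimes> z) = (x \<otimes> z) \<otimes> x" using x by (simp add: m_assoc)
      then show ?thesis using refl x sym[OF z(2)] by blast
    qed
    then show "{x, y} \<in> edges ?\<Gamma>" using x y xy unfolding edge_super_commuting_graph_iff by blast
  qed
  have link_trans: "link u w" if uvw: "link u v" "link v w" "u \<in> carrier G" for u v w
  proof (cases "u \<in> A")
    case True
    then show ?thesis using uvw by (auto simp: link_def)
  next
    case False
    then obtain z1 z2 where z: "z1 \<in> center G" "z2 \<in> center G" "(u \<otimes> z1, v) \<in> B" "(v \<otimes> z2, w) \<in> B"
      and "w \<notin> A" using uvw unfolding link_def by blast
    have c: "z1 \<in> carrier G" "z2 \<in> carrier G" using z by (auto simp: center_def)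
    have "(u \<otimes> z1 \<otimes> z2, w) \<in> B" using central[OF z(3) z(2)] z(4) trans by blast
    then have "(u \<otimes> (z1 \<otimes> z2), w) \<in> B" using c uvw by (simp add: m_assoc)
    moreover have "z1 \<otimes> z2 \<in> center G"
    proof -
      have "z1 \<otimes> z2 \<otimes> x = x \<otimes> (z1 \<otimes> z2)" if x: "x \<in> carrier G" for x
      proof -
        have comm: "z1 \<otimes> x = x \<otimes> z1" "z2 \<otimes> x = x \<otimes> z2" using x z by (auto simp: center_def)
        have "z1 \<otimes> z2 \<otimes> x = z1 \<otimes> (x \<otimes> z2)" using x c by (simp add: m_assoc comm(2))
        also have "\<dots> = (z1 \<otimes> x) \<otimes> z2" using x c by (simp add: m_assoc)
        also have "\<dots> = (x \<otimes> z1) \<otimes> z2" by (simp only: comm(1))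
        also have "\<dots> = x \<otimes> (z1 \<otimes> z2)" using x c by (simp add: m_assoc)
        finally show ?thesis .
      qed
      then show ?thesis using c by (simp add: center_def)
    qed
    ultimately show ?thesis using False \<open>w \<notin> A\<close> unfolding link_def by blast
  qed
  interpret finite_simple_graph ?\<Gamma>
    by (rule finite_simple_graph_super_commuting_graph[OF fin])
  show ?thesis
  proof
    show "center G \<subseteq> vertices ?\<Gamma>" by (auto simp: center_def)
  next
    fix c v assume c: "c \<in> center G" and v: "v \<in> vertices ?\<Gamma>" "v \<noteq> c"
    then have "c \<in> carrier G" "c \<otimes> v = v \<otimes> c" by (auto simp: center_def)
    then show "{c, v} \<in> edges ?\<Gamma>"
      unfolding edge_super_commuting_graph_iff using refl v by auto
  next
    fix u v w
    assume e: "{u, v} \<in> edges ?\<Gamma>" "{v, w} \<in> edges ?\<Gamma>" "u \<noteq> w"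
      and nz: "u \<notin> center G" "v \<notin> center G" "w \<notin> center G"
    have c: "u \<in> carrier G" "v \<in> carrier G" "w \<in> carrier G"
      using e unfolding edge_super_commuting_graph_iff by blast+
    then show "{u, w} \<in> edges ?\<Gamma>" using e nz edge_iff link_trans by blast
  qed
qed

lemma dominated_cluster_graph_ESCom:
  assumes "finite (carrier G)"
  shows "dominated_cluster_graph (ESCom G) (center G)"
  unfolding ESCom_def
proof (rule dominated_cluster_graph_super_commuting_graph[OF assms])
  show "equiv (carrier G) (Id_on (carrier G))"
    by (intro equivI) (auto simp: refl_on_def sym_def trans_def)
  show "Id_on (carrier G) \<subseteq> conjugacy_rel G"
  proof
    fix p assume "p \<in> Id_on (carrier G)"
    then obtain x where x: "p = (x, x)" "x \<in> carrier G" by auto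
    then have "x = \<one> \<otimes> x \<otimes> inv \<one>" by simp
    then show "p \<in> conjugacy_rel G" using x unfolding conjugacy_rel_def by blast
  qed
qed (auto simp: center_def)

lemma dominated_cluster_graph_CSCom:
  assumes "finite (carrier G)"
  shows "dominated_cluster_graph (CSCom G) (center G)"
  unfolding CSCom_def
proof (rule dominated_cluster_graph_super_commuting_graph[OF assms])
  show "equiv (carrier G) (conjugacy_rel G)"
  proof (rule equivI)
    show "conjugacy_rel G \<subseteq> carrier G \<times> carrier G" by (auto simp: conjugacy_rel_def)
    show "refl_on (carrier G) (conjugacy_rel G)"
    proof (rule refl_onI)
      fix x assume x: "x \<in> carrier G"
      then have "x = \<one> \<otimes> x \<otimes> inv \<one>" by simp
      then show "(x, x) \<in> conjugacy_rel G" using x unfolding conjugacy_rel_def by blast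
    qed
    show "sym (conjugacy_rel G)"
    proof (rule symI)
      fix x y assume "(x, y) \<in> conjugacy_rel G"
      then obtain g where g: "g \<in> carrier G" "x \<in> carrier G" "y = g \<otimes> x \<otimes> inv g"
        unfolding conjugacy_rel_def by auto
      then have "x = inv g \<otimes> y \<otimes> inv (inv g)" by (simp add: conj_inverse)
      moreover have "inv g \<in> carrier G" "y \<in> carrier G" using g by auto
      ultimately show "(y, x) \<in> conjugacy_rel G" using g(2) unfolding conjugacy_rel_def by blast
    qed
    show "trans (conjugacy_rel G)"
    proof (rule transI)
      fix x y w assume "(x, y) \<in> conjugacy_rel G" "(y, w) \<in> conjugacy_rel G"
      then obtain g h where gh: "g \<in> carrier G" "h \<in> carrier G" "x \<in> carrier G"
        "y = g \<otimes> x \<otimes> inv g" "w = h \<otimes> y \<otimes> inv h"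
        unfolding conjugacy_rel_def by auto
      then have "w = (h \<otimes> g) \<otimes> x \<otimes> inv (h \<otimes> g)" by (simp add: m_assoc inv_mult_group)
      moreover have "h \<otimes> g \<in> carrier G" "w \<in> carrier G" using gh by auto
      ultimately show "(x, w) \<in> conjugacy_rel G" using gh(3) unfolding conjugacy_rel_def by blast
    qed
  qed
next
  fix x y z assume xy: "(x, y) \<in> conjugacy_rel G" and z: "z \<in> center G"
  obtain g where g: "g \<in> carrier G" "x \<in> carrier G" "y = g \<otimes> x \<otimes> inv g"
    using xy unfolding conjugacy_rel_def by auto
  have zc: "z \<in> carrier G" "inv g \<otimes> z = z \<otimes> inv g" using z g by (auto simp: center_def)
  have "y \<otimes> z = g \<otimes> (x \<otimes> z) \<otimes> inv g" using g zc by (simp add: m_assoc)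
  moreover have "x \<otimes> z \<in> carrier G" "y \<otimes> z \<in> carrier G" using g zc by auto
  ultimately show "(x \<otimes> z, y \<otimes> z) \<in> conjugacy_rel G" using g(1) unfolding conjugacy_rel_def by blast
qed simp

end

section \<open>Order super commuting graphs of p-groups\<close>

lemma (in group) power_of_given_order:
  assumes "x \<in> carrier G" "y \<in> carrier G" "ord x dvd ord y" "ord y \<noteq> 0"
  shows "\<exists>k :: nat. ord (y [^] k) = ord x \<and> y [^] k \<otimes> y = y \<otimes> y [^] k"
proof -
  obtain k where k: "ord y = ord x * k" using assms(3) by (auto simp: dvd_def)
  then have "k \<noteq> 0" "ord x \<noteq> 0" using assms(4) by auto
  then have "ord (y [^] k) = ord x" using assms(2) k by (simp add: ord_pow)
  moreover have "y [^] k \<otimes> y = y \<otimes> y [^] k" using assms(2) nat_pow_comm[of y k 1] by simp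
  ultimately show ?thesis by blast
qed

text \<open>Orders of elements of a p-group form a chain under divisibility, so of any two elements one
  has a power with the order of the other. Hence the graph is complete, that is, every vertex is
  dominating.\<close>

lemma (in group) dominated_cluster_graph_OSCom:
  assumes fin: "finite (carrier G)" and p: "prime (p :: nat)"
    and p_group: "\<And>x. x \<in> carrier G \<Longrightarrow> x [^] (p ^ k) = \<one>"
  shows "dominated_cluster_graph (OSCom G) (carrier G)"
proof -
  have ord: "\<exists>i. ord x = p ^ i" if "x \<in> carrier G" for x
    using p_group[OF that] that divides_primepow_nat[OF p] by (auto simp: pow_eq_id)
  have nz: "ord x \<noteq> 0" if "x \<in> carrier G" for x
    using ord[OF that] p prime_gt_0_nat by fastforce
  have commuting: "\<exists>x'\<in>same_order_rel G `` {x}. \<exists>y'\<in>same_order_rel G `` {y}. x' \<otimes> y' = y' \<otimes> x'"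
    if x: "x \<in> carrier G" and y: "y \<in> carrier G" for x y
  proof -
    obtain i j where ij: "ord x = p ^ i" "ord y = p ^ j" using ord x y by blast
    consider "ord x dvd ord y" | "ord y dvd ord x"
      unfolding ij by (meson le_imp_power_dvd nat_le_linear)
    then show ?thesis
    proof cases
      case 1
      then obtain k :: nat where "ord (y [^] k) = ord x" "y [^] k \<otimes> y = y \<otimes> y [^] k"
        using power_of_given_order x y nz by metis
      then have "y [^] k \<in> same_order_rel G `` {x}" "y \<in> same_order_rel G `` {y}"
        using x y by (simp_all add: same_order_rel_def)
      then show ?thesis using \<open>y [^] k \<otimes> y = y \<otimes> y [^] k\<close> by blast
    next
      case 2
      then obtain k :: nat where "ord (x [^] k) = ord y" "x [^] k \<otimes> x = x \<otimes> x [^] k"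
        using power_of_given_order x y nz by metis
      then have "x [^] k \<in> same_order_rel G `` {y}" "x \<in> same_order_rel G `` {x}"
        using x y by (simp_all add: same_order_rel_def)
      then show ?thesis using \<open>x [^] k \<otimes> x = x \<otimes> x [^] k\<close>[symmetric] by blast
    qed
  qed
  interpret finite_simple_graph "OSCom G"
    unfolding OSCom_def by (rule finite_simple_graph_super_commuting_graph[OF fin])
  show ?thesis
  proof
    fix c v assume "c \<in> carrier G" "v \<in> vertices (OSCom G)" "v \<noteq> c"
    then show "{c, v} \<in> edges (OSCom G)"
      using commuting[of c v] by (auto simp: OSCom_def edge_super_commuting_graph_iff)
  next
    fix u v w assume "{u, v} \<in> edges (OSCom G)" "u \<notin> carrier G"
    then show "{u, w} \<in> edges (OSCom G)" by (simp add: OSCom_def edge_super_commuting_graph_iff)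
  qed (simp add: OSCom_def)
qed

section \<open>The structure of the quasidihedral group\<close>

text \<open>The relations of the quasidihedral presentation, with \<open>n\<close> and \<open>r\<close> for the two
  exponents and the last relation solved for \<open>\<beta> \<otimes> \<alpha>\<close>, the form in which it moves \<open>\<beta>\<close> to the
  right. The elements \<open>\<alpha> [^] i\<close> and \<open>\<alpha> [^] i \<otimes> \<beta>\<close> are called rotations and reflections as in
  the dihedral case, although such a reflection may have order four.\<close>

locale cyclic_by_involution = group G for G (structure) +
  fixes \<alpha> \<beta> and n r :: nat
  assumes \<alpha>_closed [simp]: "\<alpha> \<in> carrier G" and \<beta>_closed [simp]: "\<beta> \<in> carrier G"
    and n_pos: "n > 0" and \<alpha>_pow: "\<alpha> [^] n = \<one>" and \<beta>_sq: "\<beta> \<otimes> \<beta> = \<one>"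
    and \<beta>_\<alpha>: "\<beta> \<otimes> \<alpha> = \<alpha> [^] r \<otimes> \<beta>"
begin

definition rotations where
  "rotations = range (\<lambda>i :: nat. \<alpha> [^] i)"

definition normal_forms where
  "normal_forms = rotations \<union> range (\<lambda>i :: nat. \<alpha> [^] i \<otimes> \<beta>)"

lemma \<beta>_\<alpha>_pow: "\<beta> \<otimes> \<alpha> [^] (i :: nat) = \<alpha> [^] (r * i) \<otimes> \<beta>"
proof (induction i)
  case (Suc i)
  have "\<beta> \<otimes> \<alpha> [^] Suc i = (\<beta> \<otimes> \<alpha> [^] i) \<otimes> \<alpha>" by (simp add: m_assoc)
  also have "\<dots> = \<alpha> [^] (r * i) \<otimes> (\<beta> \<otimes> \<alpha>)" by (simp add: Suc.IH m_assoc)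
  also have "\<dots> = (\<alpha> [^] (r * i) \<otimes> \<alpha> [^] r) \<otimes> \<beta>" by (simp add: \<beta>_\<alpha> m_assoc)
  also have "\<dots> = \<alpha> [^] (r * Suc i) \<otimes> \<beta>" by (simp add: nat_pow_mult add.commute)
  finally show ?case .
qed simp

lemma reflection_mult:
  "(\<alpha> [^] (i :: nat) \<otimes> \<beta>) \<otimes> (\<alpha> [^] (j :: nat) \<otimes> \<beta>) = \<alpha> [^] (i + r * j)"
proof -
  have "(\<alpha> [^] i \<otimes> \<beta>) \<otimes> (\<alpha> [^] j \<otimes> \<beta>) = \<alpha> [^] i \<otimes> (\<beta> \<otimes> \<alpha> [^] j) \<otimes> \<beta>" by (simp add: m_assoc)
  also have "\<dots> = (\<alpha> [^] i \<otimes> \<alpha> [^] (r * j)) \<otimes> (\<beta> \<otimes> \<beta>)" by (simp add: \<beta>_\<alpha>_pow m_assoc)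
  also have "\<dots> = \<alpha> [^] (i + r * j)" by (simp add: \<beta>_sq nat_pow_mult)
  finally show ?thesis .
qed

lemma one_normal_form: "\<one> \<in> normal_forms"
  unfolding normal_forms_def rotations_def using nat_pow_0[of \<alpha>] by (metis UnI1 rangeI)

lemma \<alpha>_pow_mult_normal_form:
  assumes "x \<in> normal_forms"
  shows "\<alpha> [^] (j :: nat) \<otimes> x \<in> normal_forms"
proof -
  obtain i :: nat where "x = \<alpha> [^] i \<or> x = \<alpha> [^] i \<otimes> \<beta>"
    using assms by (auto simp: normal_forms_def rotations_def)
  then have "\<alpha> [^] j \<otimes> x = \<alpha> [^] (j + i) \<or> \<alpha> [^] j \<otimes> x = \<alpha> [^] (j + i) \<otimes> \<beta>"
    by (auto simp: nat_pow_mult simp flip: m_assoc)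
  then show ?thesis by (auto simp: normal_forms_def rotations_def)
qed

lemma \<beta>_mult_normal_form:
  assumes "x \<in> normal_forms"
  shows "\<beta> \<otimes> x \<in> normal_forms"
proof -
  obtain i :: nat where "x = \<alpha> [^] i \<or> x = \<alpha> [^] i \<otimes> \<beta>"
    using assms by (auto simp: normal_forms_def rotations_def)
  then have "\<beta> \<otimes> x = \<alpha> [^] (r * i) \<otimes> \<beta> \<or> \<beta> \<otimes> x = \<alpha> [^] (r * i)"
    using \<beta>_\<alpha>_pow[of i] reflection_mult[of 0 i] by auto
  then show ?thesis by (auto simp: normal_forms_def rotations_def)
qed

lemma inv_\<alpha>: "inv \<alpha> = \<alpha> [^] (n - 1)"
proof -
  have "\<alpha> [^] (n - 1) \<otimes> \<alpha> = \<one>" using \<alpha>_pow n_pos by (metis Suc_diff_1 nat_pow_Suc)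
  then show ?thesis by (simp add: inv_equality)
qed

lemma inv_\<beta>: "inv \<beta> = \<beta>"
  using \<beta>_sq by (simp add: inv_equality)

lemma subgroup_rotations: "subgroup rotations G"
proof
  show "rotations \<subseteq> carrier G" by (auto simp: rotations_def)
  show "\<one> \<in> rotations" unfolding rotations_def using nat_pow_0[of \<alpha>] by (metis rangeI)
next
  fix x y assume "x \<in> rotations" "y \<in> rotations"
  then show "x \<otimes> y \<in> rotations" by (auto simp: rotations_def nat_pow_mult)
next
  fix x assume "x \<in> rotations"
  then obtain i :: nat where "x = \<alpha> [^] i" by (auto simp: rotations_def)
  then have "inv x = \<alpha> [^] ((n - 1) * i)" by (simp add: inv_\<alpha> nat_pow_pow flip: nat_pow_inv)
  then show "inv x \<in> rotations" by (simp add: rotations_def)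
qed

context
  assumes generated: "carrier G \<subseteq> normal_forms"
begin

lemma abelian_index_two_rotations: "abelian_index_two G rotations"
proof (intro abelian_index_two.intro abelian_index_two_axioms.intro)
  show "group G" ..
  show "subgroup rotations G" by (rule subgroup_rotations)
next
  fix x y assume "x \<in> rotations" "y \<in> rotations"
  then show "x \<otimes> y = y \<otimes> x" by (auto simp: rotations_def nat_pow_mult add.commute)
next
  fix x y assume "x \<in> carrier G - rotations" "y \<in> carrier G - rotations"
  then obtain i j :: nat where "x = \<alpha> [^] i \<otimes> \<beta>" "y = \<alpha> [^] j \<otimes> \<beta>"
    using generated by (fastforce simp: normal_forms_def)
  then show "x \<otimes> y \<in> rotations" by (simp add: reflection_mult rotations_def)
qed

lemma finite_generated: "finite (carrier G)"
proof -
  have "\<alpha> [^] i \<in> (\<lambda>i. \<alpha> [^] i) ` {..<n}" for i :: nat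
  proof -
    have "\<alpha> [^] i = \<alpha> [^] (n * (i div n) + i mod n)" by simp
    also have "\<dots> = (\<alpha> [^] n) [^] (i div n) \<otimes> \<alpha> [^] (i mod n)"
      by (simp only: nat_pow_pow nat_pow_mult \<alpha>_closed)
    also have "\<dots> = \<alpha> [^] (i mod n)" by (simp add: \<alpha>_pow)
    finally show ?thesis using n_pos by auto
  qed
  then have "finite rotations"
    unfolding rotations_def by (intro finite_subset[OF image_subsetI finite_imageI[of "{..<n}"]]) auto
  moreover have "normal_forms = rotations \<union> (\<lambda>x. x \<otimes> \<beta>) ` rotations"
    by (auto simp: normal_forms_def rotations_def)
  ultimately show ?thesis using generated by (simp add: finite_subset)
qed

lemma pow_generated:
  assumes "x \<in> carrier G"
  shows "x [^] (2 * n) = \<one>"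
proof -
  have rot: "y [^] n = \<one>" if y: "y \<in> rotations" for y
  proof -
    obtain i :: nat where "y = \<alpha> [^] i" using y by (auto simp: rotations_def)
    then have "y [^] n = (\<alpha> [^] n) [^] i" by (simp add: nat_pow_pow mult.commute)
    then show ?thesis by (simp add: \<alpha>_pow)
  qed
  have "x [^] (2 :: nat) \<in> rotations"
  proof (cases "x \<in> rotations")
    case True
    then show ?thesis
      using subgroup.m_closed[OF subgroup_rotations] assms by (simp add: numeral_2_eq_2)
  next
    case False
    then show ?thesis
      using abelian_index_two.index_A[OF abelian_index_two_rotations] assms
      by (simp add: numeral_2_eq_2)
  qed
  then have "(x [^] (2 :: nat)) [^] n = \<one>" by (rule rot)
  then show ?thesis using assms by (simp add: nat_pow_pow)
qed

end

end

text \<open>The set of normal forms is closed under left multiplication by the generators and their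
  inverses, so induction on words shows that it contains every element of the presented group.\<close>

lemma quasidihedral_structure:
  obtains \<alpha> \<beta> where "cyclic_by_involution (quasidihedral m) \<alpha> \<beta> (2 ^ (m - 1)) (2 ^ (m - 2) - 1)"
    "carrier (quasidihedral m)
      \<subseteq> cyclic_by_involution.normal_forms (quasidihedral m) \<alpha> \<beta>"
proof -
  define R where "R = {(wpow (gen qd_gen.a) (2 ^ (m - 1)), []), (wpow (gen qd_gen.b) 2, []),
     (gen qd_gen.b @ gen qd_gen.a @ gen_inv qd_gen.b, wpow (gen qd_gen.a) (2 ^ (m - 2) - 1))}"
  define G where "G = quasidihedral m"
  have G: "G = presented_group R" by (simp add: G_def quasidihedral_def R_def)
  define cls where "cls w = pres_rel_set R `` {w}" for w
  interpret group G unfolding G by (rule group_presented_group)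
  have carrier: "carrier G = range cls"
    by (auto simp: G presented_group_def quotient_def cls_def)
  have closed [simp]: "cls w \<in> carrier G" for w by (simp add: carrier)
  have one: "\<one>\<^bsub>G\<^esub> = cls []" by (simp add: G presented_group_def cls_def)
  have mult: "cls (v @ w) = cls v \<otimes>\<^bsub>G\<^esub> cls w" for v w
    by (simp add: G cls_def presented_group_mult)
  have eqI: "cls v = cls w" if "pres_eq R v w" for v w
    unfolding cls_def using that
    by (intro equiv_class_eq[OF equiv_pres_rel_set]) (simp add: pres_rel_set_def)
  have rel: "cls l = cls r" if "(l, r) \<in> R" for l r
    using pres_rel[OF that, of "[]" "[]"] eqI by simp
  have pow: "cls (wpow w k) = cls w [^]\<^bsub>G\<^esub> k" for w k
  proof (induction k)
    case (Suc k)
    have "cls (wpow w (Suc k)) = cls w \<otimes>\<^bsub>G\<^esub> cls w [^]\<^bsub>G\<^esub> k" using Suc.IH by (simp add: wpow_def mult)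
    then show ?case using nat_pow_Suc2[of "cls w" k] by simp
  qed (simp add: wpow_def one)
  have gen_inv: "cls [(x, False)] = inv\<^bsub>G\<^esub> cls [(x, True)]" for x
  proof -
    have "cls [(x, False), (x, True)] = \<one>\<^bsub>G\<^esub>"
      using eqI[OF pres_cancel[of R "[]" x False "[]"]] by (simp add: one)
    then have "cls [(x, False)] \<otimes>\<^bsub>G\<^esub> cls [(x, True)] = \<one>\<^bsub>G\<^esub>" by (simp flip: mult)
    then show ?thesis by (simp add: inv_equality)
  qed
  define \<alpha> where "\<alpha> = cls [(qd_gen.a, True)]"
  define \<beta> where "\<beta> = cls [(qd_gen.b, True)]"
  have in_G [simp]: "\<alpha> \<in> carrier G" "\<beta> \<in> carrier G" by (simp_all add: \<alpha>_def \<beta>_def)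
  interpret cyclic_by_involution G \<alpha> \<beta> "2 ^ (m - 1)" "2 ^ (m - 2) - 1"
  proof
    show "\<alpha> [^]\<^bsub>G\<^esub> (2 ^ (m - 1) :: nat) = \<one>\<^bsub>G\<^esub>"
      using rel[of "wpow (gen qd_gen.a) (2 ^ (m - 1))" "[]"]
      by (simp add: R_def pow one \<alpha>_def gen_def)
    have "\<beta> [^]\<^bsub>G\<^esub> (2 :: nat) = \<one>\<^bsub>G\<^esub>"
      using rel[of "wpow (gen qd_gen.b) 2" "[]"] by (simp add: R_def pow one \<beta>_def gen_def)
    then show "\<beta> \<otimes>\<^bsub>G\<^esub> \<beta> = \<one>\<^bsub>G\<^esub>" by (simp add: numeral_2_eq_2)
    have "\<beta> \<otimes>\<^bsub>G\<^esub> (\<alpha> \<otimes>\<^bsub>G\<^esub> inv\<^bsub>G\<^esub> \<beta>) = \<alpha> [^]\<^bsub>G\<^esub> (2 ^ (m - 2) - 1 :: nat)"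
      using rel[of "gen qd_gen.b @ gen qd_gen.a @ gen_inv qd_gen.b"
          "wpow (gen qd_gen.a) (2 ^ (m - 2) - 1)"]
      unfolding mult pow by (simp add: R_def \<alpha>_def \<beta>_def gen_def gen_inv_def gen_inv)
    then have "\<alpha> [^]\<^bsub>G\<^esub> (2 ^ (m - 2) - 1 :: nat) \<otimes>\<^bsub>G\<^esub> \<beta> = \<beta> \<otimes>\<^bsub>G\<^esub> (\<alpha> \<otimes>\<^bsub>G\<^esub> inv\<^bsub>G\<^esub> \<beta>) \<otimes>\<^bsub>G\<^esub> \<beta>"
      by simp
    also have "\<dots> = \<beta> \<otimes>\<^bsub>G\<^esub> \<alpha>" by (simp add: m_assoc)
    finally show "\<beta> \<otimes>\<^bsub>G\<^esub> \<alpha> = \<alpha> [^]\<^bsub>G\<^esub> (2 ^ (m - 2) - 1 :: nat) \<otimes>\<^bsub>G\<^esub> \<beta>" by simp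
  qed simp_all
  have words: "cls w \<in> normal_forms" for w
  proof (induction w)
    case Nil
    show ?case using one_normal_form by (simp add: one)
  next
    case (Cons p w)
    obtain x s where p: "p = (x, s)" by (cases p)
    have "cls (p # w) = cls [p] \<otimes>\<^bsub>G\<^esub> cls w" by (simp flip: mult)
    moreover have "\<alpha> \<otimes>\<^bsub>G\<^esub> cls w \<in> normal_forms"
      using \<alpha>_pow_mult_normal_form[OF Cons.IH, of 1] by simp
    moreover have "inv\<^bsub>G\<^esub> \<alpha> \<otimes>\<^bsub>G\<^esub> cls w \<in> normal_forms"
      unfolding inv_\<alpha> by (rule \<alpha>_pow_mult_normal_form[OF Cons.IH])
    moreover have "\<beta> \<otimes>\<^bsub>G\<^esub> cls w \<in> normal_forms" by (rule \<beta>_mult_normal_form[OF Cons.IH])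
    ultimately show ?case
      by (cases x; cases s) (simp_all add: p gen_inv inv_\<beta> flip: \<alpha>_def \<beta>_def)
  qed
  show thesis
  proof (rule that)
    show "cyclic_by_involution (quasidihedral m) \<alpha> \<beta> (2 ^ (m - 1)) (2 ^ (m - 2) - 1)"
      using cyclic_by_involution_axioms by (simp add: G_def)
    show "carrier (quasidihedral m) \<subseteq> cyclic_by_involution.normal_forms (quasidihedral m) \<alpha> \<beta>"
      using words carrier by (auto simp flip: G_def)
  qed
qed

theorem corollary3p6:
  fixes m :: nat
  assumes "m \<ge> 3"
  shows "\<forall>\<Gamma> \<in> {ESCom (quasidihedral m), CSCom (quasidihedral m), OSCom (quasidihedral m)}.
    real (zagreb2 \<Gamma>) / real (card (edges \<Gamma>)) \<ge> real (zagreb1 \<Gamma>) / real (card (vertices \<Gamma>))"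
proof -
  let ?G = "quasidihedral m"
  obtain \<alpha> \<beta> where cyc: "cyclic_by_involution ?G \<alpha> \<beta> (2 ^ (m - 1)) (2 ^ (m - 2) - 1)"
    and gen: "carrier ?G \<subseteq> cyclic_by_involution.normal_forms ?G \<alpha> \<beta>"
    by (rule quasidihedral_structure)
  interpret cyclic_by_involution ?G \<alpha> \<beta> "2 ^ (m - 1)" "2 ^ (m - 2) - 1" by (rule cyc)
  have fin: "finite (carrier ?G)" by (rule finite_generated[OF gen])
  interpret abelian_index_two ?G rotations by (rule abelian_index_two_rotations[OF gen])
  have "x [^]\<^bsub>?G\<^esub> (2 ^ m :: nat) = \<one>\<^bsub>?G\<^esub>" if "x \<in> carrier ?G" for x
    using pow_generated[OF gen that] assms by (simp flip: power_Suc)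
  then have "dominated_cluster_graph (OSCom ?G) (carrier ?G)"
    by (intro dominated_cluster_graph_OSCom[OF fin two_is_prime_nat])
  then show ?thesis
    using dominated_cluster_graph_ESCom[OF fin] dominated_cluster_graph_CSCom[OF fin]
    by (auto intro: dominated_cluster_graph.hansen_vukicevic)
qed

end
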